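(* Let $T$ be a finite nonempty set of integers, all $>1$, and $M=\max_{t\in T}(t-1)$. Let $A$ be the adjacency matrix of the one-step shift of finite type $Y_T$, $U$ the unsigned binary de Bruijn matrix on $\mathbb F_2^M$, and $B$ the signed binary de Bruijn matrix attached to $T$ (defined in the context). Then after Fourier transformation in the second coordinate $s\in\mathbb F_2$, the matrix $A$ is similar over $\mathbb R$ to the block diagonal matrix $$\begin{pmatrix}U&0\\0&B\end{pmatrix}.$$ Consequently $$\det(I-zA)=(1-2z)\det(I-zB).$$
   Context: For $a=(a_0,\dots,a_{M-1})\in\mathbb F_2^M$ and $\varepsilon\in\mathbb F_2$ put $\sigma_\varepsilon(a)=(a_1,\dots,a_{M-1},\varepsilon)$. $Y_T$ is the one-step shift of finite type of the directed graph with vertex set $\mathbb F_2^M\times\mathbb F_2$ and an edge $(a,s)\to\left(\sigma_\varepsilon(a),\,s+\varepsilon\sum_{t\in T}a_{M-t+1}\right)$ for each vertex $(a,s)$ and each $\varepsilon\in\mathbb F_2$. Its adjacency matrix $A$ has $A_{u,v}=1$ if there is an edge $u\to v$, and $A_{u,v}=0$ otherwise. $U$ is indexed by $\mathbb F_2^M$, with $U_{a,b}=1$ if $b=\sigma_\varepsilon(a)$ for some $\varepsilon\in\mathbb F_2$, and $0$ otherwise. $B$ is indexed by $\mathbb F_2^M$, with $B_{a,b}=(-1)^{\varepsilon\sum_{t\in T}a_{M-t+1}}$ if $b=\sigma_\varepsilon(a)$, $\varepsilon\in\mathbb F_2$, and $0$ otherwise. Fourier transformation in the second coordinate means the change of basis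 from the standard basis $e_{(a,s)}$ to the vectors $\frac1{\sqrt2}\sum_{s\in\mathbb F_2}(-1)^{rs}e_{(a,s)}$, $a\in\mathbb F_2^M$, $r\in\mathbb F_2$, ordered with all pairs $(a,0)$ first and then all pairs $(a,1)$. *)

theory Defs
  imports "Jordan_Normal_Form.Char_Poly" "HOL-Library.Z2"
begin

text \<open>Words $a = (a_0,\dots,a_{M-1}) \in \mathbb{F}_2^M$ are elements of
  \<^term>\<open>carrier_vec M :: bit vec set\<close>.\<close>

definition window :: "int set \<Rightarrow> nat" where
  "window T = nat (Max ((\<lambda>t. t - 1) ` T))"

definition shift_in :: "nat \<Rightarrow> bit \<Rightarrow> bit vec \<Rightarrow> bit vec" where
  "shift_in M \<epsilon> a = vec M (\<lambda>i. if i + 1 < M then a $ (i + 1) else \<epsilon>)"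

definition tap_sum :: "int set \<Rightarrow> bit vec \<Rightarrow> bit" where
  "tap_sum T a = (\<Sum>t\<in>T. a $ nat (int (window T) - t + 1))"

text \<open>The real number $(-1)^x$ for $x \in \mathbb{F}_2$.\<close>

definition sign_bit :: "bit \<Rightarrow> real" where
  "sign_bit x = (if x = 0 then 1 else -1)"

definition Y_vertices :: "int set \<Rightarrow> (bit vec \<times> bit) set" where
  "Y_vertices T = carrier_vec (window T) \<times> UNIV"

definition Y_edges :: "int set \<Rightarrow> ((bit vec \<times> bit) \<times> (bit vec \<times> bit)) set" where
  "Y_edges T = {((a, s), (shift_in (window T) \<epsilon> a, s + \<epsilon> * tap_sum T a)) | a s \<epsilon>.
                  (a, s) \<in> Y_vertices T}"

text \<open>Matrices indexed by finite sets are turned into matrices with numbered rows and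
  columns by means of lists enumerating the index sets.\<close>

definition enumerates :: "'i list \<Rightarrow> 'i set \<Rightarrow> bool" where
  "enumerates xs X \<longleftrightarrow> distinct xs \<and> set xs = X"

definition indexed_mat :: "'i list \<Rightarrow> 'j list \<Rightarrow> ('i \<Rightarrow> 'j \<Rightarrow> 'c) \<Rightarrow> 'c mat" where
  "indexed_mat xs ys f = mat (length xs) (length ys) (\<lambda>(i, j). f (xs ! i) (ys ! j))"

definition Y_adjacency :: "int set \<Rightarrow> (bit vec \<times> bit) list \<Rightarrow> real mat" where
  "Y_adjacency T us = indexed_mat us us (\<lambda>u v. if (u, v) \<in> Y_edges T then 1 else 0)"

definition de_bruijn :: "int set \<Rightarrow> bit vec list \<Rightarrow> real mat" where
  "de_bruijn T ws = indexed_mat ws ws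
     (\<lambda>a b. if \<exists>\<epsilon>. b = shift_in (window T) \<epsilon> a then 1 else 0)"

text \<open>The description below is proper when \<^term>\<open>window T \<ge> 1\<close>: then \<open>\<epsilon>\<close> is the last
  coordinate of \<open>b\<close>.\<close>

definition signed_de_bruijn :: "int set \<Rightarrow> bit vec list \<Rightarrow> real mat" where
  "signed_de_bruijn T ws = indexed_mat ws ws
     (\<lambda>a b. if \<exists>\<epsilon>. b = shift_in (window T) \<epsilon> a
            then sign_bit ((THE \<epsilon>. b = shift_in (window T) \<epsilon> a) * tap_sum T a)
            else 0)"

text \<open>The coordinate at \<open>u\<close> of the vector
  $\frac{1}{\sqrt 2}\sum_{s\in\mathbb{F}_2} (-1)^{rs} e_{(a,s)}$.\<close>

definition fourier_vector :: "bit vec \<times> bit \<Rightarrow> bit vec \<times> bit \<Rightarrow> real" where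
  "fourier_vector = (\<lambda>(a, r) u.
     1 / sqrt 2 * (\<Sum>s\<in>UNIV. sign_bit (r * s) * (if u = (a, s) then 1 else 0)))"

text \<open>The columns are the new basis vectors, all pairs \<open>(a, 0)\<close> first and then all pairs
  \<open>(a, 1)\<close>; the rows are the standard coordinates in the order \<open>us\<close>.\<close>

definition fourier_mat :: "(bit vec \<times> bit) list \<Rightarrow> bit vec list \<Rightarrow> real mat" where
  "fourier_mat us ws =
     indexed_mat us (map (\<lambda>a. (a, 0)) ws @ map (\<lambda>a. (a, 1)) ws) (\<lambda>u p. fourier_vector p u)"

definition block_diag :: "real mat \<Rightarrow> real mat \<Rightarrow> real mat" where
  "block_diag C D = four_block_mat C (0\<^sub>m (dim_row C) (dim_col D)) (0\<^sub>m (dim_row D) (dim_col C)) D"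

text \<open>$\det(I - zC)$ as a polynomial in the indeterminate $z$, which is \<^term>\<open>[:0, 1:] :: real poly\<close>.\<close>

definition det_one_minus_z :: "real mat \<Rightarrow> real poly" where
  "det_one_minus_z C = det (1\<^sub>m (dim_row C) - [:0, 1:] \<cdot>\<^sub>m map_mat (\<lambda>c. [:c:]) C)"

end

theory Submission
  imports Defs
begin

text \<open>The edges of \<open>Y\<^sub>T\<close> are equivariant under translation of the second coordinate, so the
  characters of \<open>\<bbbF>\<^sub>2\<close> split \<open>A\<close> into the trivial part \<open>U\<close> and the sign part \<open>B\<close>. For the
  determinant of \<open>U\<close>, factor the de Bruijn matrix on words of length \<open>M + 1\<close> as \<open>E F\<close>, where
  \<open>E\<close> deletes the first and \<open>F\<close> appends a last letter; then \<open>F E\<close> is the de Bruijn matrix on words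
  of length \<open>M\<close>, and \<open>det (I - z E F) = det (I - z F E)\<close> reduces to \<open>M = 0\<close>, where the matrix
  is \<open>(2)\<close>.\<close>

section \<open>Matrices indexed by enumerated sets\<close>

lemma dim_indexed_mat [simp]:
  "dim_row (indexed_mat xs ys f) = length xs" "dim_col (indexed_mat xs ys f) = length ys"
  by (simp_all add: indexed_mat_def)

lemma indexed_mat_carrier [simp]:
  assumes "length xs = n" "length ys = m"
  shows "indexed_mat xs ys f \<in> carrier_mat n m"
  using assms by (simp add: indexed_mat_def)

lemma indexed_mat_cong:
  assumes "\<And>x y. x \<in> set xs \<Longrightarrow> y \<in> set ys \<Longrightarrow> f x y = g x y"
  shows "indexed_mat xs ys f = indexed_mat xs ys g"
  by (rule eq_matI) (auto simp: indexed_mat_def intro!: assms)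

lemma indexed_mat_one:
  assumes "distinct xs"
  shows "indexed_mat xs xs (\<lambda>x y. if x = y then 1 else 0) = 1\<^sub>m (length xs)"
  by (rule eq_matI) (auto simp: indexed_mat_def nth_eq_iff_index_eq[OF assms])

lemma indexed_mat_mult:
  fixes f :: "'a \<Rightarrow> 'b \<Rightarrow> 'd :: semiring_0"
  assumes "distinct ys"
  shows "indexed_mat xs ys f * indexed_mat ys zs g =
    indexed_mat xs zs (\<lambda>x z. \<Sum>y\<in>set ys. f x y * g y z)"
proof (rule eq_matI)
  have reindex: "(\<Sum>k = 0..<length ys. h (ys ! k)) = (\<Sum>y\<in>set ys. h y)" for h :: "'b \<Rightarrow> 'd"
    using sum.reindex_bij_betw[OF bij_betw_nth[OF assms refl refl], of h]
    by (simp add: atLeast0LessThan)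
  fix i j
  assume "i < dim_row (indexed_mat xs zs (\<lambda>x z. \<Sum>y\<in>set ys. f x y * g y z))"
    and "j < dim_col (indexed_mat xs zs (\<lambda>x z. \<Sum>y\<in>set ys. f x y * g y z))"
  then show "(indexed_mat xs ys f * indexed_mat ys zs g) $$ (i, j) =
      indexed_mat xs zs (\<lambda>x z. \<Sum>y\<in>set ys. f x y * g y z) $$ (i, j)"
    by (simp add: indexed_mat_def scalar_prod_def reindex[symmetric])
qed auto

section \<open>The polynomial \<open>det (I - z C)\<close>\<close>

text \<open>Lets the embedding of real matrices as constant polynomial matrices pass through
  products.\<close>

interpretation const_poly_hom: comm_ring_hom "\<lambda>c :: real. [:c:]"
  by unfold_locales (auto simp: one_pCons)

text \<open>Sylvester's identity. Both sides are determinants of Schur complements of the block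
  matrix with rows \<open>(1, X)\<close> and \<open>(Y, 1)\<close>: it factors as
  \<open>?S * ?L\<close> and as \<open>?L * ?R\<close> with the same unitriangular
  \<open>?L\<close>.\<close>

lemma det_one_minus_mult_commute:
  fixes X Y :: "'a :: idom mat"
  assumes X: "X \<in> carrier_mat n m" and Y: "Y \<in> carrier_mat m n"
  shows "det (1\<^sub>m n - X * Y) = det (1\<^sub>m m - Y * X)"
proof -
  let ?L = "four_block_mat (1\<^sub>m n) (0\<^sub>m n m) Y (1\<^sub>m m)"
  let ?S = "four_block_mat (1\<^sub>m n - X * Y) X (0\<^sub>m m n) (1\<^sub>m m)"
  let ?R = "four_block_mat (1\<^sub>m n) X (0\<^sub>m m n) (1\<^sub>m m - Y * X)"
  have XY: "X * Y \<in> carrier_mat n n" and YX: "Y * X \<in> carrier_mat m m"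
    using mult_carrier_mat[OF X Y] mult_carrier_mat[OF Y X] .
  have cancel: "1\<^sub>m n - X * Y + X * Y = 1\<^sub>m n" "Y * X + (1\<^sub>m m - Y * X) = 1\<^sub>m m"
    using X Y by (auto intro!: eq_matI)
  have "?S * ?L = four_block_mat (1\<^sub>m n) X Y (1\<^sub>m m)"
    using X Y by (subst mult_four_block_mat[of _ n n _ m _ m _ _ n _ m]) (auto simp: cancel)
  moreover have "?L * ?R = four_block_mat (1\<^sub>m n) X Y (1\<^sub>m m)"
    using X Y by (subst mult_four_block_mat[of _ n n _ m _ m _ _ n _ m]) (auto simp: cancel)
  ultimately have "?S * ?L = ?L * ?R" by simp
  moreover have "?L \<in> carrier_mat (n + m) (n + m)" "?S \<in> carrier_mat (n + m) (n + m)"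
    "?R \<in> carrier_mat (n + m) (n + m)"
    using X Y by (auto intro!: four_block_carrier_mat)
  ultimately have "det ?S * det ?L = det ?L * det ?R"
    by (metis det_mult)
  moreover have "det ?L = 1"
    using det_four_block_mat_upper_right_zero[of "1\<^sub>m n" n _ m Y "1\<^sub>m m"] Y by simp
  moreover have "det ?S = det (1\<^sub>m n - X * Y)"
    using det_four_block_mat_lower_left_zero[of "1\<^sub>m n - X * Y" n X m "0\<^sub>m m n" "1\<^sub>m m"] X XY
    by (simp add: minus_carrier_mat)
  moreover have "det ?R = det (1\<^sub>m m - Y * X)"
    using det_four_block_mat_lower_left_zero[of "1\<^sub>m n" n X m "0\<^sub>m m n" "1\<^sub>m m - Y * X"] X YX
    by (simp add: minus_carrier_mat)
  ultimately show ?thesis by simp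
qed

lemma det_one_minus_z_mult_commute:
  assumes E: "E \<in> carrier_mat n m" and F: "F \<in> carrier_mat m n"
  shows "det_one_minus_z (E * F) = det_one_minus_z (F * E)"
proof -
  let ?E = "map_mat (\<lambda>c. [:c:]) E" and ?F = "map_mat (\<lambda>c. [:c:]) F"
  let ?z = "[:0, 1:] :: real poly"
  have E': "?E \<in> carrier_mat n m" and F': "?F \<in> carrier_mat m n"
    using E F by auto
  \<comment> \<open>The indeterminate is absorbed into the factor \<open>E\<close>, so that
    Sylvester's identity applies to \<open>z E\<close> and \<open>F\<close>.\<close>
  have "det_one_minus_z (E * F) = det (1\<^sub>m n - (?z \<cdot>\<^sub>m ?E) * ?F)"
    using E F by (simp add: det_one_minus_z_def const_poly_hom.mat_hom_mult[OF E F]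
      mult_smult_assoc_mat[OF E' F'])
  also have "\<dots> = det (1\<^sub>m m - ?F * (?z \<cdot>\<^sub>m ?E))"
    using E' F' by (intro det_one_minus_mult_commute) auto
  also have "\<dots> = det_one_minus_z (F * E)"
    using E F by (simp add: det_one_minus_z_def const_poly_hom.mat_hom_mult[OF F E]
      mult_smult_distrib[OF F' E'])
  finally show ?thesis .
qed

text \<open>Cyclic invariance suffices: \<open>C = P (D Q)\<close> may be rotated to
  \<open>D Q P\<close>, where \<open>Q P\<close> cancels.\<close>

lemma det_one_minus_z_similar:
  assumes "similar_mat_wit C D P Q"
  shows "det_one_minus_z C = det_one_minus_z D"
proof -
  define n where "n = dim_row C"
  note sim = similar_mat_witD[OF n_def assms]
  have "det_one_minus_z C = det_one_minus_z (P * (D * Q))"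
    using sim by (simp add: assoc_mult_mat[of P n n D n Q n])
  also have "\<dots> = det_one_minus_z (D * Q * P)"
    using sim by (intro det_one_minus_z_mult_commute[of _ n n]) auto
  also have "D * Q * P = D"
    using sim by (simp add: assoc_mult_mat[of D n n Q n P n])
  finally show ?thesis .
qed

lemma det_one_minus_z_block_diag:
  assumes C: "C \<in> carrier_mat n n" and D: "D \<in> carrier_mat m m"
  shows "det_one_minus_z (block_diag C D) = det_one_minus_z C * det_one_minus_z D"
proof -
  let ?I = "\<lambda>k K. 1\<^sub>m k - [:0, 1:] \<cdot>\<^sub>m map_mat (\<lambda>c. [:c:]) (K :: real mat)"
  have "?I (n + m) (block_diag C D) = four_block_mat (?I n C) (0\<^sub>m n m) (0\<^sub>m m n) (?I m D)"
    using C D by (intro eq_matI) (auto simp: block_diag_def)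
  moreover have "det \<dots> = det (?I n C) * det (?I m D)"
    using C D by (intro det_four_block_mat_upper_right_zero) auto
  ultimately show ?thesis
    using C D by (simp add: det_one_minus_z_def block_diag_def)
qed

section \<open>The de Bruijn matrix with multiplicities\<close>

lemma UNIV_bit: "(UNIV :: bit set) = {0, 1}"
  by (auto simp: bit_not_zero_iff)

lemma finite_UNIV_bit: "finite (UNIV :: bit set)"
  by (simp add: UNIV_bit)

lemma sum_bit: "(\<Sum>x\<in>UNIV. f x) = f 0 + f (1 :: bit)"
  by (simp add: UNIV_bit)

lemma finite_carrier_vec_bit: "finite (carrier_vec n :: bit vec set)"
proof -
  have "finite {xs :: bit list. set xs \<subseteq> UNIV \<and> length xs = n}"
    by (rule finite_lists_length_eq) (simp add: UNIV_bit)
  moreover have "carrier_vec n \<subseteq> vec_of_list ` {xs :: bit list. set xs \<subseteq> UNIV \<and> length xs = n}"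
  proof
    fix v :: "bit vec"
    assume "v \<in> carrier_vec n"
    then have "v = vec_of_list (list_of_vec v)" "length (list_of_vec v) = n"
      by (auto simp: vec_list)
    then show "v \<in> vec_of_list ` {xs :: bit list. set xs \<subseteq> UNIV \<and> length xs = n}"
      by blast
  qed
  ultimately show ?thesis by (rule finite_surj)
qed

lemma shift_in_carrier [simp]: "shift_in M \<epsilon> a \<in> carrier_vec M"
  by (simp add: shift_in_def)

text \<open>The incoming letter is the last coordinate, which exists once the length is positive.
  This makes the letter in the definition of \<open>signed_de_bruijn\<close> unique.\<close>

lemma shift_in_eq_iff:
  assumes "M \<ge> 1"
  shows "shift_in M \<epsilon> a = shift_in M \<delta> a \<longleftrightarrow> \<epsilon> = \<delta>"
proof
  assume "shift_in M \<epsilon> a = shift_in M \<delta> a"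
  then have "shift_in M \<epsilon> a $ (M - 1) = shift_in M \<delta> a $ (M - 1)" by simp
  then show "\<epsilon> = \<delta>" using assms by (simp add: shift_in_def)
qed simp

text \<open>Counting the letters \<open>\<epsilon>\<close> gives the value 2 at length 0, where \<^const>\<open>de_bruijn\<close> would have
  the entry 1.\<close>

definition shift_count :: "nat \<Rightarrow> bit vec \<Rightarrow> bit vec \<Rightarrow> real" where
  "shift_count M a b = (\<Sum>\<epsilon>\<in>UNIV. if b = shift_in M \<epsilon> a then 1 else 0)"

text \<open>For positive length the two letters give different words, so at most one term of the
  count is nonzero.\<close>

lemma shift_count_eq:
  assumes "M \<ge> 1"
  shows "shift_count M = (\<lambda>a b. if \<exists>\<epsilon>. b = shift_in M \<epsilon> a then 1 else 0)"
proof (intro ext)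
  fix a b
  show "shift_count M a b = (if \<exists>\<epsilon>. b = shift_in M \<epsilon> a then 1 else 0)"
  proof (cases "\<exists>\<epsilon>. b = shift_in M \<epsilon> a")
    case True
    then obtain \<delta> where "b = shift_in M \<delta> a" by blast
    then show ?thesis
      using assms by (auto simp: shift_count_def shift_in_eq_iff UNIV_bit)
  qed (auto simp: shift_count_def)
qed

definition vec_snoc :: "'a vec \<Rightarrow> 'a \<Rightarrow> 'a vec" where
  "vec_snoc c x = vec (Suc (dim_vec c)) (\<lambda>i. if i < dim_vec c then c $ i else x)"

definition vec_tail :: "'a vec \<Rightarrow> 'a vec" where
  "vec_tail a = vec (dim_vec a - 1) (\<lambda>i. a $ Suc i)"

lemma vec_snoc_carrier: "c \<in> carrier_vec n \<Longrightarrow> vec_snoc c x \<in> carrier_vec (Suc n)"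
  by (auto simp: vec_snoc_def)

lemma vec_tail_carrier: "a \<in> carrier_vec (Suc n) \<Longrightarrow> vec_tail a \<in> carrier_vec n"
  by (auto simp: vec_tail_def)

text \<open>Deleting and then appending is the shift on the longer words; in the opposite order,
  treated next, it is the shift on the shorter ones. These give \<open>E F\<close> and
  \<open>F E\<close> in the induction below.\<close>

lemma vec_snoc_tail:
  assumes "a \<in> carrier_vec (Suc n)"
  shows "vec_snoc (vec_tail a) \<epsilon> = shift_in (Suc n) \<epsilon> a"
  using assms by (intro eq_vecI) (auto simp: vec_snoc_def vec_tail_def shift_in_def)

lemma vec_tail_snoc:
  assumes "c \<in> carrier_vec n"
  shows "vec_tail (vec_snoc c \<epsilon>) = shift_in n \<epsilon> c"
  using assms by (intro eq_vecI) (auto simp: vec_snoc_def vec_tail_def shift_in_def)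

text \<open>Induction on the length. The enumeration stays arbitrary because the step passes to a
  list \<open>vs\<close> of the shorter words.\<close>

lemma det_one_minus_z_shift_count:
  assumes "enumerates ws (carrier_vec n)"
  shows "det_one_minus_z (indexed_mat ws ws (shift_count n)) = [:1, -2:]"
  using assms
proof (induction n arbitrary: ws)
  case 0
  have "(carrier_vec 0 :: bit vec set) = {0\<^sub>v 0}" by (auto intro!: eq_vecI)
  then have "length ws = 1" "set ws = {0\<^sub>v 0}"
    using 0 distinct_card[of ws] by (auto simp: enumerates_def)
  then have ws: "ws = [0\<^sub>v 0]" by (cases ws) auto
  \<comment> \<open>Both letters return the empty word to itself; this double loop is the source of
    the factor \<open>1 - 2z\<close>.\<close>
  have "shift_count 0 (0\<^sub>v 0) (0\<^sub>v 0) = 2"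
    by (auto simp: shift_count_def shift_in_def sum_bit zero_vec_def)
  then have "det_one_minus_z (indexed_mat ws ws (shift_count 0)) = 1 - [:0, 1:] * [:2:]"
    by (subst det_one_minus_z_def, subst det_single) (simp_all add: ws indexed_mat_def minus_carrier_mat)
  also have "\<dots> = [:1, -2:]"
    by (rule poly_eqI) (simp add: coeff_pCons split: nat.split)
  finally show ?case .
next
  case (Suc n)
  obtain vs :: "bit vec list" where vs: "set vs = carrier_vec n" "distinct vs"
    using finite_distinct_list[OF finite_carrier_vec_bit] by blast
  have ws: "set ws = carrier_vec (Suc n)" "distinct ws"
    using Suc.prems by (auto simp: enumerates_def)
  define E :: "real mat" where
    "E = indexed_mat ws vs (\<lambda>a c. if c = vec_tail a then 1 else 0)"
  define F :: "real mat" where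
    "F = indexed_mat vs ws (\<lambda>c b. \<Sum>\<epsilon>\<in>UNIV. if b = vec_snoc c \<epsilon> then 1 else 0)"
  have "E * F = indexed_mat ws ws (shift_count (Suc n))"
    unfolding E_def F_def indexed_mat_mult[OF vs(2)]
  proof (rule indexed_mat_cong)
    fix a b
    assume a: "a \<in> set ws"
    have "(\<Sum>c\<in>set vs. (if c = vec_tail a then 1 else 0) *
        (\<Sum>\<epsilon>\<in>UNIV. if b = vec_snoc c \<epsilon> then 1 else 0)) =
      (\<Sum>c\<in>set vs. if c = vec_tail a then
        (\<Sum>\<epsilon>\<in>UNIV. if b = vec_snoc c \<epsilon> then 1 else 0 :: real) else 0)"
      by (intro sum.cong) auto
    also have "\<dots> = (\<Sum>\<epsilon>\<in>UNIV. if b = vec_snoc (vec_tail a) \<epsilon> then 1 else 0)"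
      using a vec_tail_carrier[of a n] by (simp add: ws vs finite_carrier_vec_bit)
    also have "\<dots> = shift_count (Suc n) a b"
      using a by (simp add: ws vec_snoc_tail shift_count_def)
    finally show "(\<Sum>c\<in>set vs. (if c = vec_tail a then 1 else 0) *
        (\<Sum>\<epsilon>\<in>UNIV. if b = vec_snoc c \<epsilon> then 1 else 0)) = shift_count (Suc n) a b" .
  qed
  moreover have "F * E = indexed_mat vs vs (shift_count n)"
    unfolding E_def F_def indexed_mat_mult[OF ws(2)]
  proof (rule indexed_mat_cong)
    fix c d
    assume c: "c \<in> set vs"
    have "(\<Sum>b\<in>set ws. (\<Sum>\<epsilon>\<in>UNIV. if b = vec_snoc c \<epsilon> then 1 else 0) *
        (if d = vec_tail b then 1 else 0)) =
      (\<Sum>b\<in>set ws. \<Sum>\<epsilon>\<in>UNIV. if b = vec_snoc c \<epsilon> then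
        (if d = vec_tail b then 1 else 0 :: real) else 0)"
      unfolding sum_distrib_right by (intro sum.cong) auto
    \<comment> \<open>With the letter fixed first, the sum over \<open>b\<close> collapses to the
      single word \<open>vec_snoc c \<epsilon>\<close>.\<close>
    also have "\<dots> = (\<Sum>\<epsilon>\<in>UNIV. \<Sum>b\<in>set ws. if b = vec_snoc c \<epsilon> then
        (if d = vec_tail b then 1 else 0 :: real) else 0)"
      by (rule sum.swap)
    also have "\<dots> = (\<Sum>\<epsilon>\<in>UNIV. if d = vec_tail (vec_snoc c \<epsilon>) then 1 else 0)"
      using c vec_snoc_carrier[of c n] by (simp add: ws vs finite_carrier_vec_bit)
    also have "\<dots> = shift_count n c d"
      using c by (simp add: vs vec_tail_snoc shift_count_def)
    finally show "(\<Sum>b\<in>set ws. (\<Sum>\<epsilon>\<in>UNIV. if b = vec_snoc c \<epsilon> then 1 else 0) *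
        (if d = vec_tail b then 1 else 0)) = shift_count n c d" .
  qed
  moreover have "det_one_minus_z (E * F) = det_one_minus_z (F * E)"
    by (rule det_one_minus_z_mult_commute[of _ "length ws" "length vs"]) (simp_all add: E_def F_def)
  ultimately show ?case
    using Suc.IH[of vs] vs by (simp add: enumerates_def)
qed

lemma det_one_minus_z_de_bruijn:
  assumes "window T \<ge> 1" "enumerates ws (carrier_vec (window T))"
  shows "det_one_minus_z (de_bruijn T ws) = [:1, -2:]"
  using det_one_minus_z_shift_count[OF assms(2)]
  by (simp add: de_bruijn_def shift_count_eq[OF assms(1)])

section \<open>Fourier transformation in the second coordinate\<close>

lemma window_ge_1:
  assumes "finite T" "T \<noteq> {}" "\<And>t. t \<in> T \<Longrightarrow> t > 1"
  shows "window T \<ge> 1"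
proof -
  have "Max ((\<lambda>t. t - 1) ` T) \<in> (\<lambda>t. t - 1) ` T"
    using assms by (intro Max_in) auto
  then show ?thesis using assms(3) by (force simp: window_def)
qed

lemma fourier_vector_eq:
  "fourier_vector (a, r) (b, s) = (if a = b then sign_bit (r * s) / sqrt 2 else 0)"
  by (cases s) (auto simp: fourier_vector_def sum_bit)

text \<open>One family for both characters of the second coordinate: \<open>r = 0\<close> makes
  every sign trivial and gives U, \<open>r = 1\<close> gives B.\<close>

definition signed_shift :: "int set \<Rightarrow> bit \<Rightarrow> bit vec \<Rightarrow> bit vec \<Rightarrow> real" where
  "signed_shift T r a b = (if \<exists>\<epsilon>. b = shift_in (window T) \<epsilon> a
     then sign_bit (r * ((THE \<epsilon>. b = shift_in (window T) \<epsilon> a) * tap_sum T a)) else 0)"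

lemma signed_shift_shift_in:
  assumes "window T \<ge> 1"
  shows "signed_shift T r a (shift_in (window T) \<epsilon> a) = sign_bit (r * (\<epsilon> * tap_sum T a))"
  using assms by (auto simp: signed_shift_def shift_in_eq_iff)

text \<open>Listing all pairs with second entry 0 first makes the four blocks correspond to the
  values of \<open>(q, r)\<close>; the test \<open>q = r\<close> kills the off-diagonal
  ones.\<close>

lemma block_diag_eq_indexed_mat:
  fixes f :: "bit \<Rightarrow> 'a \<Rightarrow> 'a \<Rightarrow> real"
  defines "ps \<equiv> \<lambda>ws. map (\<lambda>a. (a, 0)) ws @ map (\<lambda>a. (a, 1)) ws"
  shows "block_diag (indexed_mat ws ws (f 0)) (indexed_mat ws ws (f 1)) =
    indexed_mat (ps ws) (ps ws) (\<lambda>(a, q) (b, r). if q = r then f r a b else 0)"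
  by (rule eq_matI) (auto simp: ps_def block_diag_def indexed_mat_def nth_append)

theorem theorem5p1:
  fixes T :: "int set" and ws :: "bit vec list" and us :: "(bit vec \<times> bit) list"
  assumes "finite T" and "T \<noteq> {}" and "\<And>t. t \<in> T \<Longrightarrow> t > 1"
    and "enumerates ws (carrier_vec (window T))"
    and "enumerates us (Y_vertices T)"
  shows "(\<exists>Q. similar_mat_wit (Y_adjacency T us)
                (block_diag (de_bruijn T ws) (signed_de_bruijn T ws)) (fourier_mat us ws) Q)
       \<and> det_one_minus_z (Y_adjacency T us) =
           [:1, -2:] * det_one_minus_z (signed_de_bruijn T ws)"
proof -
  let ?M = "window T"
  define W where "W = (carrier_vec ?M :: bit vec set)"
  define ps where "ps = map (\<lambda>a. (a, 0 :: bit)) ws @ map (\<lambda>a. (a, 1)) ws"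
  have M: "?M \<ge> 1" using assms(1-3) by (rule window_ge_1)
  have fin: "finite W" by (simp add: W_def finite_carrier_vec_bit)
  have ws: "set ws = W" "distinct ws"
    using assms(4) by (auto simp: enumerates_def W_def)
  have us: "set us = W \<times> UNIV" "distinct us"
    using assms(5) by (auto simp: enumerates_def W_def Y_vertices_def)
  have ps: "set ps = W \<times> UNIV" "distinct ps"
    using ws by (auto simp: ps_def UNIV_bit distinct_map inj_on_def)
  have len: "length ps = length us"
    using distinct_card[OF ps(2)] distinct_card[OF us(2)] by (simp add: ps us)
  let ?n = "length us"
  define A where "A = Y_adjacency T us"
  define P where "P = indexed_mat us ps (\<lambda>u p. fourier_vector p u)"
  \<comment> \<open>\<open>Q\<close> is the transpose of \<open>P\<close>: the Fourier vectors are
    real and orthonormal, so it is the inverse.\<close>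
  define Q where "Q = indexed_mat ps us fourier_vector"
  define D where
    "D = indexed_mat ps ps (\<lambda>(a, q) (b, r). if q = r then signed_shift T r a b else 0)"
  have P_eq: "fourier_mat us ws = P"
    by (simp add: fourier_mat_def P_def ps_def)
  have "de_bruijn T ws = indexed_mat ws ws (signed_shift T 0)"
    "signed_de_bruijn T ws = indexed_mat ws ws (signed_shift T 1)"
    by (auto simp: de_bruijn_def signed_de_bruijn_def signed_shift_def sign_bit_def
        intro!: indexed_mat_cong)
  then have D_eq: "block_diag (de_bruijn T ws) (signed_de_bruijn T ws) = D"
    by (simp add: D_def ps_def block_diag_eq_indexed_mat)
  have carrier: "A \<in> carrier_mat ?n ?n" "P \<in> carrier_mat ?n ?n" "Q \<in> carrier_mat ?n ?n"
    "D \<in> carrier_mat ?n ?n"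
    unfolding A_def Y_adjacency_def P_def Q_def D_def
    by (rule indexed_mat_carrier; rule refl len)+
  have PQ: "P * Q = 1\<^sub>m ?n"
    unfolding P_def Q_def indexed_mat_mult[OF ps(2)] indexed_mat_one[OF us(2), symmetric]
  proof (rule indexed_mat_cong)
    fix u v :: "bit vec \<times> bit"
    assume u: "u \<in> set us"
    obtain a s b t where uv: "u = (a, s)" "v = (b, t)" by fastforce
    have "(\<Sum>p\<in>set ps. fourier_vector p u * fourier_vector p v) =
        (\<Sum>c\<in>W. \<Sum>r\<in>UNIV. fourier_vector (c, r) u * fourier_vector (c, r) v)"
      by (simp add: ps sum.cartesian_product)
    \<comment> \<open>Orthogonality of characters: \<open>r = 0\<close> contributes 1/2 and
      \<open>r = 1\<close> contributes half the product of the signs, so the total is 1 or 0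
      according to whether \<open>s = t\<close>.\<close>
    also have "\<dots> = (\<Sum>c\<in>W. if c = a then if a = b then
        (1 + sign_bit s * sign_bit t) / 2 else 0 else 0)"
      by (intro sum.cong) (auto simp: uv fourier_vector_eq sum_bit sign_bit_def)
    also have "\<dots> = (if a = b then (1 + sign_bit s * sign_bit t) / 2 else 0)"
      using u fin by (simp add: us uv)
    also have "\<dots> = (if u = v then 1 else 0)"
      by (cases s; cases t) (auto simp: uv sign_bit_def)
    finally show "(\<Sum>p\<in>set ps. fourier_vector p u * fourier_vector p v) =
      (if u = v then 1 else 0)" .
  qed
  have QP: "Q * P = 1\<^sub>m ?n"
    by (rule mat_mult_left_right_inverse[OF carrier(2,3) PQ])
  \<comment> \<open>The intertwining relation is checked entrywise: both sides at
    \<open>(a, s)\<close>, \<open>(b, r)\<close> reduce to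
    \<open>sign_bit (r * s) / sqrt 2 * signed_shift T r a b\<close>.\<close>
  have "A * P = P * D"
    unfolding A_def Y_adjacency_def P_def D_def indexed_mat_mult[OF us(2)]
      indexed_mat_mult[OF ps(2)]
  proof (rule indexed_mat_cong)
    fix u p :: "bit vec \<times> bit"
    assume u: "u \<in> set us" and p: "p \<in> set ps"
    obtain a s b r where up: "u = (a, s)" "p = (b, r)" by fastforce
    have aW: "a \<in> W" and bW: "b \<in> W" using u p by (auto simp: up us ps)
    have edge: "((a, s), (c, t)) \<in> Y_edges T \<longleftrightarrow>
        (\<exists>\<epsilon>. c = shift_in ?M \<epsilon> a \<and> t = s + \<epsilon> * tap_sum T a)" for c t
      using aW by (auto simp: Y_edges_def Y_vertices_def W_def)
    have "(\<Sum>v\<in>set us. (if (u, v) \<in> Y_edges T then 1 else 0) * fourier_vector p v) =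
        (\<Sum>c\<in>W. \<Sum>t\<in>UNIV. (if (u, (c, t)) \<in> Y_edges T then 1 else 0) * fourier_vector p (c, t))"
      by (simp add: us sum.cartesian_product)
    also have "\<dots> = (\<Sum>c\<in>W. if c = b then
        \<Sum>t\<in>UNIV. if (u, (b, t)) \<in> Y_edges T then sign_bit (r * t) / sqrt 2 else 0 else 0)"
      by (intro sum.cong) (auto simp: up fourier_vector_eq intro!: sum.cong)
    also have "\<dots> = (\<Sum>t\<in>UNIV. if (u, (b, t)) \<in> Y_edges T then sign_bit (r * t) / sqrt 2 else 0)"
      using fin bW by simp
    \<comment> \<open>If \<open>b\<close> follows \<open>a\<close> by the letter
      \<open>\<delta>\<close>, the only target is \<open>t = s + \<delta> * tap_sum T a\<close>, and
      the character turns this sum into a product of signs. Otherwise both sides vanish.\<close>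
    also have "\<dots> = sign_bit (r * s) / sqrt 2 * signed_shift T r a b"
    proof (cases "\<exists>\<epsilon>. b = shift_in ?M \<epsilon> a")
      case True
      then obtain \<delta> where b: "b = shift_in ?M \<delta> a" by blast
      have "(u, (b, t)) \<in> Y_edges T \<longleftrightarrow> t = s + \<delta> * tap_sum T a" for t
        unfolding up edge b using M by (auto simp: shift_in_eq_iff)
      then show ?thesis
        by (simp add: b signed_shift_shift_in[OF M] sign_bit_def finite_UNIV_bit)
    next
      case False
      then show ?thesis by (auto simp: up edge signed_shift_def)
    qed
    also have "\<dots> = (\<Sum>c\<in>W. if c = a then
        sign_bit (r * s) / sqrt 2 * signed_shift T r a b else 0)"
      using fin aW by simp
    \<comment> \<open>The single term is expanded into the entry of \<open>P * D\<close>: the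
      Fourier vector forces \<open>c = a\<close>, the block structure forces
      \<open>q = r\<close>.\<close>
    also have "\<dots> = (\<Sum>c\<in>W. \<Sum>q\<in>UNIV. fourier_vector (c, q) u *
        (if q = r then signed_shift T r c b else 0))"
      by (intro sum.cong) (cases r; auto simp: up fourier_vector_eq sum_bit)+
    also have "\<dots> = (\<Sum>q\<in>set ps. fourier_vector q u *
        (case q of (a, q) \<Rightarrow> \<lambda>(b, r). if q = r then signed_shift T r a b else 0) p)"
      unfolding ps up sum.cartesian_product by (intro sum.cong) auto
    finally show "(\<Sum>v\<in>set us. (if (u, v) \<in> Y_edges T then 1 else 0) * fourier_vector p v) =
      (\<Sum>q\<in>set ps. fourier_vector q u *
        (case q of (a, q) \<Rightarrow> \<lambda>(b, r). if q = r then signed_shift T r a b else 0) p)" .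
  qed
  then have "A = P * D * Q"
    using carrier PQ by (metis assoc_mult_mat right_mult_one_mat)
  then have sim: "similar_mat_wit A D P Q"
    using PQ QP carrier by (intro similar_mat_witI)
  have "det_one_minus_z A = det_one_minus_z (de_bruijn T ws) * det_one_minus_z (signed_de_bruijn T ws)"
    unfolding det_one_minus_z_similar[OF sim] D_eq[symmetric]
    by (rule det_one_minus_z_block_diag[of _ "length ws" _ "length ws"])
      (simp_all add: de_bruijn_def signed_de_bruijn_def)
  then show ?thesis
    using sim det_one_minus_z_de_bruijn[OF M assms(4)] by (auto simp: A_def P_eq D_eq)
qed

end
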